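(* For each integer $n\ge 1$, the three additively idempotent semirings $\mathcal{U}_n$, $\mathcal{R}_n$ and $\mathcal{C}_n$ satisfy the same semiring identities, and these identities admit a finite basis.
   Context: An additively idempotent semiring (ai-semiring) is an algebra $\mathcal{S}=(S,+,\cdot)$ of type $(2,2)$ such that $(S,+)$ is a semilattice (a commutative idempotent semigroup), $(S,\cdot)$ is a semigroup, and multiplication distributes over addition on the left and on the right: $x(y+z)=xy+xz$ and $(y+z)x=yx+zx$. No constants $0$ or $1$ are included in the signature. The boolean semiring is $\mathcal{B}=\langle\{0,1\};+,\cdot\rangle$ with $0\cdot 0=0\cdot 1=1\cdot 0=0+0=0$ and $1\cdot 1=1+0=0+1=1+1=1$. $\mathcal{R}_n=\langle R_n;+,\cdot\rangle$ is the ai-semiring of all $n\times n$ matrices over $\mathcal{B}$ in which all diagonal entries are $1$, with the usual matrix addition and multiplication over $\mathcal{B}$. (Equivalently, it is the ai-semiring of all reflexive binary relations on an $n$-element set under union and multiplication of relations.) $\mathcal{U}_n=\langle U_n;+,\cdot\rangle$ is the subsemiring of $\mathcal{R}_n$ consisting of upper triangular matrices, i.e. matrices $(\alpha_{ij})$ in $R_n$ with $\alpha_{ij}=0$ for $j<i$. A transformation $\alpha$ of a partially ordered set $\langle Q;\le\rangle$ (acting on the right, $q\mapsto q.\alpha$, with $q.(\alpha\beta)=(q.\alpha).\beta$) is order preserving if $q\le q'$ implies $q.\alpha\le q'.\alpha$ for all $q,q'\in Q$, and extensive if $q\le q.\alpha$ for every $q\in Q$. $\mathcal{C}_n=\langle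 C_n;+,\cdot\rangle$ is the ai-semiring of all order preserving and extensive transformations of a chain with $n$ elements, where $\cdot$ is composition and $+$ is the pointwise supremum, $q.(\alpha+\beta)=\sup(q.\alpha,q.\beta)$. A semiring identity over an alphabet $\Sigma$ is a pair $(u_1+\cdots+u_\ell,\ v_1+\cdots+v_r)$ with $\ell,r\ge 1$ and $u_1,\dots,u_\ell,v_1,\dots,v_r\in\Sigma^+$ (nonempty words), written $u_1+\cdots+u_\ell\approx v_1+\cdots+v_r$. An ai-semiring $\mathcal{S}$ satisfies this identity if $(u_1+\cdots+u_\ell)\varphi=(v_1+\cdots+v_r)\varphi$ for every substitution $\varphi\colon\Sigma\to S$ (extended to words and sums of words in the obvious way). The identities of $\mathcal{S}$ admit a finite basis if there is a finite set of identities satisfied by $\mathcal{S}$ such that every ai-semiring satisfying this finite set satisfies all identities of $\mathcal{S}$. *)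

theory Defs
  imports "HOL-Library.Countable_Set" "HOL-Library.FuncSet" "Jordan_Normal_Form.Matrix"
begin

section \<open>Additively idempotent semirings\<close>

record 'a sr = "'a partial_object" +
  sadd :: "['a, 'a] \<Rightarrow> 'a" (infixl "\<boxplus>\<index>" 65)
  smul :: "['a, 'a] \<Rightarrow> 'a" (infixl "\<boxdot>\<index>" 70)

locale ai_semiring =
  fixes S :: "('a, 'b) sr_scheme" (structure)
  assumes nonempty: "carrier S \<noteq> {}"
    and add_closed: "\<lbrakk>x \<in> carrier S; y \<in> carrier S\<rbrakk> \<Longrightarrow> x \<boxplus> y \<in> carrier S"
    and mul_closed: "\<lbrakk>x \<in> carrier S; y \<in> carrier S\<rbrakk> \<Longrightarrow> x \<boxdot> y \<in> carrier S"
    and add_assoc: "\<lbrakk>x \<in> carrier S; y \<in> carrier S; z \<in> carrier S\<rbrakk>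
          \<Longrightarrow> (x \<boxplus> y) \<boxplus> z = x \<boxplus> (y \<boxplus> z)"
    and add_comm: "\<lbrakk>x \<in> carrier S; y \<in> carrier S\<rbrakk> \<Longrightarrow> x \<boxplus> y = y \<boxplus> x"
    and add_idem: "x \<in> carrier S \<Longrightarrow> x \<boxplus> x = x"
    and mul_assoc: "\<lbrakk>x \<in> carrier S; y \<in> carrier S; z \<in> carrier S\<rbrakk>
          \<Longrightarrow> (x \<boxdot> y) \<boxdot> z = x \<boxdot> (y \<boxdot> z)"
    and distrib_left: "\<lbrakk>x \<in> carrier S; y \<in> carrier S; z \<in> carrier S\<rbrakk>
          \<Longrightarrow> x \<boxdot> (y \<boxplus> z) = (x \<boxdot> y) \<boxplus> (x \<boxdot> z)"
    and distrib_right: "\<lbrakk>x \<in> carrier S; y \<in> carrier S; z \<in> carrier S\<rbrakk>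
          \<Longrightarrow> (y \<boxplus> z) \<boxdot> x = (y \<boxdot> x) \<boxplus> (z \<boxdot> x)"


section \<open>Semiring identities\<close>

text \<open>A word is a list of letters and a formal sum is a list of words; both have to be nonempty
  since the signature has no constants.\<close>

type_synonym 'v sr_poly = "'v list list"
type_synonym 'v sr_identity = "'v sr_poly \<times> 'v sr_poly"

definition is_sr_poly :: "'v sr_poly \<Rightarrow> bool" where
  "is_sr_poly us \<longleftrightarrow> us \<noteq> [] \<and> (\<forall>u \<in> set us. u \<noteq> [])"

definition is_sr_identity :: "'v sr_identity \<Rightarrow> bool" where
  "is_sr_identity e \<longleftrightarrow> is_sr_poly (fst e) \<and> is_sr_poly (snd e)"

text \<open>Only used on nonempty lists; the value on the empty list is unspecified.\<close>

fun fold1 :: "('a \<Rightarrow> 'a \<Rightarrow> 'a) \<Rightarrow> 'a list \<Rightarrow> 'a" where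
  "fold1 f [x] = x"
| "fold1 f (x # y # zs) = f x (fold1 f (y # zs))"

definition eval_word :: "('a, 'b) sr_scheme \<Rightarrow> ('v \<Rightarrow> 'a) \<Rightarrow> 'v list \<Rightarrow> 'a" where
  "eval_word S \<phi> w = fold1 (smul S) (map \<phi> w)"

definition eval_poly :: "('a, 'b) sr_scheme \<Rightarrow> ('v \<Rightarrow> 'a) \<Rightarrow> 'v sr_poly \<Rightarrow> 'a" where
  "eval_poly S \<phi> us = fold1 (sadd S) (map (eval_word S \<phi>) us)"

definition satisfies :: "('a, 'b) sr_scheme \<Rightarrow> 'v sr_identity \<Rightarrow> bool" where
  "satisfies S e \<longleftrightarrow>
     (\<forall>\<phi>. range \<phi> \<subseteq> carrier S \<longrightarrow> eval_poly S \<phi> (fst e) = eval_poly S \<phi> (snd e))"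

text \<open>Identities are taken over the countably infinite alphabet \<^typ>\<open>nat\<close>.\<close>

definition identities_of :: "('a, 'b) sr_scheme \<Rightarrow> nat sr_identity set" where
  "identities_of S = {e. is_sr_identity e \<and> satisfies S e}"

text \<open>The type argument \<open>'c\<close> is the type in which the carriers of the ai-semirings range; the
  formula cannot quantify over it.  Nothing depends on its size beyond countability:
  a basis with respect to \<^typ>\<open>nat\<close> is a basis with respect to every type, as shown in
  \<open>identity_basis_nat_imp_any\<close> below.\<close>

definition is_identity_basis ::
  "'c itself \<Rightarrow> ('a, 'b) sr_scheme \<Rightarrow> nat sr_identity set \<Rightarrow> bool" where
  "is_identity_basis _ S E \<longleftrightarrow> E \<subseteq> identities_of S \<and>
     (\<forall>A :: 'c sr. ai_semiring A \<and> (\<forall>e \<in> E. satisfies A e)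
        \<longrightarrow> (\<forall>e \<in> identities_of S. satisfies A e))"


section \<open>The semirings under consideration\<close>

datatype bool_sr = BZero | BOne

instantiation bool_sr :: comm_semiring_1
begin

definition "0 = BZero"
definition "1 = BOne"
definition "a + b = (if a = BZero \<and> b = BZero then BZero else BOne)"
definition "a * b = (if a = BOne \<and> b = BOne then BOne else BZero)"

instance
proof
  fix a b c :: bool_sr
  show "a * b * c = a * (b * c)" by (cases a; cases b; cases c) (simp_all add: times_bool_sr_def)
  show "a * b = b * a" by (cases a; cases b) (simp_all add: times_bool_sr_def)
  show "1 * a = a" by (cases a) (simp_all add: times_bool_sr_def one_bool_sr_def)
  show "a + b + c = a + (b + c)" by (cases a; cases b; cases c) (simp_all add: plus_bool_sr_def)
  show "a + b = b + a" by (cases a; cases b) (simp_all add: plus_bool_sr_def)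
  show "0 + a = a" by (cases a) (simp_all add: plus_bool_sr_def zero_bool_sr_def)
  show "(a + b) * c = a * c + b * c"
    by (cases a; cases b; cases c) (simp_all add: plus_bool_sr_def times_bool_sr_def)
  show "0 * a = 0" by (cases a) (simp_all add: times_bool_sr_def zero_bool_sr_def)
  show "a * 0 = 0" by (cases a) (simp_all add: times_bool_sr_def zero_bool_sr_def)
  show "(0::bool_sr) \<noteq> 1" by (simp add: zero_bool_sr_def one_bool_sr_def)
qed

end

definition R_sr :: "nat \<Rightarrow> bool_sr mat sr" where
  "R_sr n = \<lparr>carrier = {A \<in> carrier_mat n n. \<forall>i<n. A $$ (i, i) = 1}, sadd = (+), smul = (*)\<rparr>"

definition U_sr :: "nat \<Rightarrow> bool_sr mat sr" where
  "U_sr n = (R_sr n)\<lparr>carrier := {A \<in> carrier (R_sr n). upper_triangular A}\<rparr>"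

text \<open>The chain is \<open>{..<n}\<close>.  Transformations are extensional functions, so that equality of
  functions is equality of transformations; they act on the right, so the product \<open>\<alpha>\<beta>\<close>
  applies \<open>\<alpha>\<close> first.\<close>

definition C_sr :: "nat \<Rightarrow> (nat \<Rightarrow> nat) sr" where
  "C_sr n =
    \<lparr>carrier = {\<alpha> \<in> {..<n} \<rightarrow>\<^sub>E {..<n}. mono_on {..<n} \<alpha> \<and> (\<forall>q<n. q \<le> \<alpha> q)},
     sadd = (\<lambda>\<alpha> \<beta>. \<lambda>q\<in>{..<n}. sup (\<alpha> q) (\<beta> q)),
     smul = (\<lambda>\<alpha> \<beta>. compose {..<n} \<beta> \<alpha>)\<rparr>"


section \<open>Well-definedness\<close>

lemma bool_sr_add_idem: "(a::bool_sr) + a = a"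
  by (cases a) (simp_all add: plus_bool_sr_def)

lemma bool_sr_one_add: "1 + (a::bool_sr) = 1" "(a::bool_sr) + 1 = 1"
  by (simp_all add: plus_bool_sr_def one_bool_sr_def)

lemma mat_mult_diag:
  fixes A B :: "bool_sr mat"
  assumes "A \<in> carrier_mat n n" "B \<in> carrier_mat n n" "i < n"
    and "A $$ (i, i) = 1" "B $$ (i, i) = 1"
  shows "(A * B) $$ (i, i) = 1"
proof -
  have "(A * B) $$ (i, i) = (\<Sum>k \<in> {0..<n}. A $$ (i, k) * B $$ (k, i))"
    using assms by (simp add: scalar_prod_def)
  also have "\<dots> = A $$ (i, i) * B $$ (i, i) + (\<Sum>k \<in> {0..<n} - {i}. A $$ (i, k) * B $$ (k, i))"
    using assms(3) by (intro sum.remove) auto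
  also have "\<dots> = 1" using assms by (simp add: bool_sr_one_add)
  finally show ?thesis .
qed

lemma upper_triangular_mult:
  fixes A B :: "bool_sr mat"
  assumes "A \<in> carrier_mat n n" "B \<in> carrier_mat n n"
    and "upper_triangular A" "upper_triangular B"
  shows "upper_triangular (A * B)"
proof (rule upper_triangularI)
  fix i j assume ij: "j < i" "i < dim_row (A * B)"
  have "(A * B) $$ (i, j) = (\<Sum>k \<in> {0..<n}. A $$ (i, k) * B $$ (k, j))"
    using assms ij by (simp add: scalar_prod_def)
  also have "\<dots> = 0"
  proof (rule sum.neutral, rule ballI)
    fix k assume k: "k \<in> {0..<n}"
    show "A $$ (i, k) * B $$ (k, j) = 0"
    proof (cases "k < i")
      case True
      then have "A $$ (i, k) = 0" using assms ij by (auto intro: upper_triangularD)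
      then show ?thesis by simp
    next
      case False
      then have "B $$ (k, j) = 0" using assms ij k by (auto intro: upper_triangularD)
      then show ?thesis by simp
    qed
  qed
  finally show "(A * B) $$ (i, j) = 0" .
qed

lemma ai_semiring_R: "ai_semiring (R_sr n)"
proof
  show "carrier (R_sr n) \<noteq> {}"
    unfolding R_sr_def by (simp, rule exI[of _ "1\<^sub>m n"], simp)
qed (auto simp: R_sr_def bool_sr_one_add bool_sr_add_idem mat_mult_diag
      mult_add_distrib_mat[of _ n n] add_mult_distrib_mat[of _ n n] assoc_mult_mat[of _ n n _ n _ n]
      simp del: index_mult_mat intro: comm_add_mat)

lemma ai_semiring_U: "ai_semiring (U_sr n)"
proof -
  interpret R: ai_semiring "R_sr n" by (rule ai_semiring_R)
  have c: "carrier (U_sr n) \<subseteq> carrier (R_sr n)" "sadd (U_sr n) = sadd (R_sr n)"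
    "smul (U_sr n) = smul (R_sr n)" by (auto simp: U_sr_def)
  have one: "1\<^sub>m n \<in> carrier (U_sr n)" by (simp add: U_sr_def R_sr_def)
  have add: "sadd (R_sr n) A B \<in> carrier (U_sr n)"
    if "A \<in> carrier (U_sr n)" "B \<in> carrier (U_sr n)" for A B
    using that R.add_closed[of A B]
    by (auto simp: U_sr_def R_sr_def upper_triangular_def)
  have mul: "smul (R_sr n) A B \<in> carrier (U_sr n)"
    if "A \<in> carrier (U_sr n)" "B \<in> carrier (U_sr n)" for A B
    using that R.mul_closed[of A B] upper_triangular_mult[of A n B]
    by (auto simp: U_sr_def R_sr_def)
  show ?thesis
    using c one add mul
    by unfold_locales
      (auto simp: subset_iff R.add_assoc R.add_idem R.mul_assoc R.distrib_left R.distrib_right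
        intro: R.add_comm)
qed

lemma ai_semiring_C: "ai_semiring (C_sr n)"
proof
  show "carrier (C_sr n) \<noteq> {}"
    unfolding C_sr_def by (simp, rule exI[of _ "restrict id {..<n}"]) (auto simp: mono_on_def)
next
  fix x y assume "x \<in> carrier (C_sr n)" "y \<in> carrier (C_sr n)"
  then show "x \<boxplus>\<^bsub>C_sr n\<^esub> y \<in> carrier (C_sr n)"
    by (auto simp: C_sr_def mono_on_def PiE_iff le_max_iff_disj sup_nat_def)
       (meson le_less_trans le_trans nat_le_linear)+
next
  fix x y assume "x \<in> carrier (C_sr n)" "y \<in> carrier (C_sr n)"
  then show "x \<boxdot>\<^bsub>C_sr n\<^esub> y \<in> carrier (C_sr n)"
    by (auto simp: C_sr_def mono_on_def PiE_iff compose_def) (meson le_trans lessThan_iff)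
next
  fix x y z assume "x \<in> carrier (C_sr n)" "y \<in> carrier (C_sr n)" "z \<in> carrier (C_sr n)"
  then show "x \<boxdot>\<^bsub>C_sr n\<^esub> (y \<boxplus>\<^bsub>C_sr n\<^esub> z) = x \<boxdot>\<^bsub>C_sr n\<^esub> y \<boxplus>\<^bsub>C_sr n\<^esub> x \<boxdot>\<^bsub>C_sr n\<^esub> z"
    by (auto simp: C_sr_def PiE_iff compose_def fun_eq_iff)
next
  fix x y z assume "x \<in> carrier (C_sr n)" "y \<in> carrier (C_sr n)" "z \<in> carrier (C_sr n)"
  then show "(y \<boxplus>\<^bsub>C_sr n\<^esub> z) \<boxdot>\<^bsub>C_sr n\<^esub> x = y \<boxdot>\<^bsub>C_sr n\<^esub> x \<boxplus>\<^bsub>C_sr n\<^esub> z \<boxdot>\<^bsub>C_sr n\<^esub> x"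
    by (auto simp: C_sr_def PiE_iff compose_def fun_eq_iff sup_nat_def mono_on_def max_def)
       (metis lessThan_iff nle_le order_antisym)+
next
  fix x y z assume "x \<in> carrier (C_sr n)" "y \<in> carrier (C_sr n)" "z \<in> carrier (C_sr n)"
  then show "x \<boxdot>\<^bsub>C_sr n\<^esub> y \<boxdot>\<^bsub>C_sr n\<^esub> z = x \<boxdot>\<^bsub>C_sr n\<^esub> (y \<boxdot>\<^bsub>C_sr n\<^esub> z)"
    by (auto simp: C_sr_def PiE_iff compose_def fun_eq_iff)
qed (auto simp: C_sr_def fun_eq_iff sup.assoc sup.commute sup.left_commute PiE_iff extensional_def)


section \<open>Independence of the basis notion from the type of the test semirings\<close>

datatype sr_term = TVar nat | TAdd sr_term sr_term | TMul sr_term sr_term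

instance sr_term :: countable
  by countable_datatype

primrec eval_term :: "('a, 'b) sr_scheme \<Rightarrow> (nat \<Rightarrow> 'a) \<Rightarrow> sr_term \<Rightarrow> 'a" where
  "eval_term S \<phi> (TVar i) = \<phi> i"
| "eval_term S \<phi> (TAdd s t) = sadd S (eval_term S \<phi> s) (eval_term S \<phi> t)"
| "eval_term S \<phi> (TMul s t) = smul S (eval_term S \<phi> s) (eval_term S \<phi> t)"

lemma fold1_closed:
  assumes "\<And>x y. x \<in> T \<Longrightarrow> y \<in> T \<Longrightarrow> f x y \<in> T" "xs \<noteq> []" "set xs \<subseteq> T"
  shows "fold1 f xs \<in> T"
  using assms(2,3)
proof (induction xs rule: list_nonempty_induct)
  case (cons x xs)
  then show ?case by (cases xs) (auto intro: assms(1))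
qed simp

lemma fold1_hom:
  assumes closed: "\<And>x y. x \<in> T \<Longrightarrow> y \<in> T \<Longrightarrow> f x y \<in> T"
    and hom: "\<And>x y. x \<in> T \<Longrightarrow> y \<in> T \<Longrightarrow> h (f x y) = g (h x) (h y)"
    and xs: "xs \<noteq> []" "set xs \<subseteq> T"
  shows "fold1 g (map h xs) = h (fold1 f xs)"
  using xs
proof (induction xs rule: list_nonempty_induct)
  case (single x)
  then show ?case by simp
next
  case (cons x xs)
  then obtain y ys where xs: "xs = y # ys" by (cases xs) auto
  have "fold1 f xs \<in> T" using cons by (intro fold1_closed closed) auto
  then show ?case using cons hom xs by auto
qed

lemma eval_poly_hom:
  assumes add: "\<And>x y. x \<in> T \<Longrightarrow> y \<in> T \<Longrightarrow> sadd A x y \<in> T \<and> h (sadd A x y) = sadd A' (h x) (h y)"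
    and mul: "\<And>x y. x \<in> T \<Longrightarrow> y \<in> T \<Longrightarrow> smul A x y \<in> T \<and> h (smul A x y) = smul A' (h x) (h y)"
    and \<phi>: "range \<phi> \<subseteq> T" and us: "is_sr_poly us"
  shows "eval_poly A' (h \<circ> \<phi>) us = h (eval_poly A \<phi> us) \<and> eval_poly A \<phi> us \<in> T"
proof -
  have w: "eval_word A' (h \<circ> \<phi>) u = h (eval_word A \<phi> u) \<and> eval_word A \<phi> u \<in> T" if "u \<noteq> []" for u
  proof -
    have "fold1 (smul A') (map h (map \<phi> u)) = h (fold1 (smul A) (map \<phi> u))"
      using that \<phi> mul by (intro fold1_hom[of T]) auto
    moreover have "fold1 (smul A) (map \<phi> u) \<in> T"
      using that \<phi> mul by (intro fold1_closed) auto
    ultimately show ?thesis by (simp add: eval_word_def)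
  qed
  have eq: "map (eval_word A' (h \<circ> \<phi>)) us = map h (map (eval_word A \<phi>) us)"
    using us w by (simp add: is_sr_poly_def)
  have s: "set (map (eval_word A \<phi>) us) \<subseteq> T" using us w by (auto simp: is_sr_poly_def)
  have ne: "map (eval_word A \<phi>) us \<noteq> []" using us by (simp add: is_sr_poly_def)
  show ?thesis unfolding eval_poly_def eq
    using fold1_hom[of T "sadd A" h "sadd A'", OF _ _ ne s]
      fold1_closed[of T "sadd A", OF _ ne s] add by blast
qed

theorem identity_basis_nat_imp_any:
  assumes basis: "is_identity_basis TYPE(nat) S E"
  shows "is_identity_basis TYPE('c) S E"
  unfolding is_identity_basis_def
proof (intro conjI allI impI ballI)
  show "E \<subseteq> identities_of S" using basis by (simp add: is_identity_basis_def)
next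
  fix A :: "'c sr" and e
  assume A: "ai_semiring A \<and> (\<forall>e\<in>E. satisfies A e)" and e: "e \<in> identities_of S"
  interpret A: ai_semiring A using A by blast
  show "satisfies A e" unfolding satisfies_def
  proof (intro allI impI)
    fix \<phi> :: "nat \<Rightarrow> 'c" assume \<phi>: "range \<phi> \<subseteq> carrier A"
    define T where "T = range (eval_term A \<phi>)"
    define h where "h = to_nat_on T"
    define g where "g = from_nat_into T"
    have cT: "countable T" by (simp add: T_def)
    have gh: "g (h x) = x" if "x \<in> T" for x
      using that cT by (simp add: g_def h_def)
    have "eval_term A \<phi> t \<in> carrier A" for t
      using \<phi> by (induction t) (auto intro: A.add_closed A.mul_closed)
    then have TA: "x \<in> carrier A" if "x \<in> T" for x using that by (auto simp: T_def)
    have addT: "sadd A x y \<in> T" if "x \<in> T" "y \<in> T" for x y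
    proof -
      from that obtain s t where "x = eval_term A \<phi> s" "y = eval_term A \<phi> t"
        by (auto simp: T_def)
      then have "sadd A x y = eval_term A \<phi> (TAdd s t)" by simp
      then show ?thesis unfolding T_def by (rule range_eqI)
    qed
    have mulT: "smul A x y \<in> T" if "x \<in> T" "y \<in> T" for x y
    proof -
      from that obtain s t where "x = eval_term A \<phi> s" "y = eval_term A \<phi> t"
        by (auto simp: T_def)
      then have "smul A x y = eval_term A \<phi> (TMul s t)" by simp
      then show ?thesis unfolding T_def by (rule range_eqI)
    qed
    have \<phi>T: "range \<phi> \<subseteq> T"
    proof
      fix x assume "x \<in> range \<phi>"
      then obtain i where "x = eval_term A \<phi> (TVar i)" by auto
      then show "x \<in> T" unfolding T_def by (rule range_eqI)
    qed
    define A' :: "nat sr" where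
      "A' = \<lparr>carrier = h ` T, sadd = (\<lambda>x y. h (sadd A (g x) (g y))),
             smul = (\<lambda>x y. h (smul A (g x) (g y)))\<rparr>"
    have commT: "h (sadd A x y) = h (sadd A y x)" if "x \<in> T" "y \<in> T" for x y
      using A.add_comm[OF TA TA, OF that] by simp
    have A': "ai_semiring A'"
      using \<phi>T
      by unfold_locales
        (auto simp: A'_def gh addT mulT TA A.add_assoc A.add_idem A.mul_assoc A.distrib_left
          A.distrib_right TA intro: commT)
    have eval: "eval_poly A' (h \<circ> \<psi>) us = h (eval_poly A \<psi> us) \<and> eval_poly A \<psi> us \<in> T"
      if "range \<psi> \<subseteq> T" "is_sr_poly us" for \<psi> us
      using that by (intro eval_poly_hom) (auto simp: A'_def addT mulT gh)
    have "satisfies A' e'" if e': "e' \<in> E" for e'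
      unfolding satisfies_def
    proof (intro allI impI)
      fix \<psi>' :: "nat \<Rightarrow> nat" assume \<psi>': "range \<psi>' \<subseteq> carrier A'"
      define \<psi> where "\<psi> = g \<circ> \<psi>'"
      have \<psi>: "range \<psi> \<subseteq> T" "\<psi>' = h \<circ> \<psi>"
        using \<psi>' gh by (auto simp: \<psi>_def A'_def fun_eq_iff image_subset_iff) (metis gh imageE)+
      have "range \<psi> \<subseteq> carrier A" using \<psi>(1) TA by blast
      then have "eval_poly A \<psi> (fst e') = eval_poly A \<psi> (snd e')"
        using A e' by (auto simp: satisfies_def)
      moreover have "is_sr_identity e'"
        using e' basis by (auto simp: is_identity_basis_def identities_of_def)
      ultimately show "eval_poly A' \<psi>' (fst e') = eval_poly A' \<psi>' (snd e')"
        using eval[OF \<psi>(1)] unfolding \<psi>(2) is_sr_identity_def by simp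
    qed
    then have "satisfies A' e"
      using A' basis e by (auto simp: is_identity_basis_def)
    moreover have "range (h \<circ> \<phi>) \<subseteq> carrier A'" using \<phi>T by (auto simp: A'_def)
    ultimately have "eval_poly A' (h \<circ> \<phi>) (fst e) = eval_poly A' (h \<circ> \<phi>) (snd e)"
      by (auto simp: satisfies_def)
    then show "eval_poly A \<phi> (fst e) = eval_poly A \<phi> (snd e)"
      using eval[OF \<phi>T] e gh unfolding identities_of_def is_sr_identity_def
      by (metis (mono_tags, lifting) mem_Collect_eq)
  qed
qed

end

theory Submission
  imports Defs "HOL-Library.Sublist"
begin

text \<open>The identities turn out to be exactly the pairs of polynomials whose words have, jointly, the
  same scattered subwords of length less than \<open>n\<close>.  For \<open>n \<ge> 2\<close> a basis is given by
  \<open>x + xy = xy\<close>, \<open>y + xy = xy\<close> and the identity equating \<open>x\<^sub>1\<cdots>x\<^sub>n\<close> with the sum of the words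
  obtained from it by deleting one letter: the last one rewrites every word as a sum of words
  shorter than \<open>n\<close>, the first two bound a word from below by its subwords.
  The relations in \<open>\<R>\<^sub>n\<close> satisfy the last identity because a walk with \<open>n\<close> steps revisits a vertex.
  Since \<open>\<C>\<^sub>n\<close> embeds into \<open>\<U>\<^sub>n \<subseteq> \<R>\<^sub>n\<close>, it remains to see that a transformation in \<open>\<C>\<^sub>n\<close> can detect
  any given subword of length less than \<open>n\<close>.\<close>

section \<open>Deleting letters from words\<close>

definition deletions :: "'a list \<Rightarrow> 'a list list" where
  "deletions xs = map (\<lambda>i. take i xs @ drop (Suc i) xs) [0..<length xs]"

lemma deletionsE:
  assumes "ys \<in> set (deletions xs)"
  obtains as a bs where "xs = as @ a # bs" "ys = as @ bs"
proof -
  from assms obtain i where "i < length xs" "ys = take i xs @ drop (Suc i) xs"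
    by (auto simp: deletions_def)
  then show thesis using that id_take_nth_drop by blast
qed

lemma length_deletions: "ys \<in> set (deletions xs) \<Longrightarrow> Suc (length ys) = length xs"
  by (elim deletionsE) simp

lemma subseq_deletions: "ys \<in> set (deletions xs) \<Longrightarrow> subseq ys xs"
  by (elim deletionsE) (simp add: list_emb_append_mono subseq_Cons')

lemma subseq_concat_map: "subseq xs ys \<Longrightarrow> subseq (concat (map f xs)) (concat (map f ys))"
  by (induction rule: list_emb.induct) (auto intro: list_emb_append_mono list_emb_append2)

section \<open>Evaluation in ai-semirings\<close>

lemma eval_word_single [simp]: "eval_word S \<phi> [x] = \<phi> x"
  by (simp add: eval_word_def)

lemma eval_word_Cons: "u \<noteq> [] \<Longrightarrow> eval_word S \<phi> (x # u) = smul S (\<phi> x) (eval_word S \<phi> u)"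
  by (cases u) (simp_all add: eval_word_def)

lemma eval_poly_single [simp]: "eval_poly S \<phi> [u] = eval_word S \<phi> u"
  by (simp add: eval_poly_def)

lemma eval_poly_Cons:
  "us \<noteq> [] \<Longrightarrow> eval_poly S \<phi> (u # us) = sadd S (eval_word S \<phi> u) (eval_poly S \<phi> us)"
  by (cases us) (simp_all add: eval_poly_def)

section \<open>The order of an ai-semiring, and the evaluation of words and polynomials\<close>

context ai_semiring
begin

text \<open>The semilattice order with \<open>\<boxplus>\<close> as join. In it, the first two basis
  identities say that a product lies above each of its factors.\<close>

definition le :: "'a \<Rightarrow> 'a \<Rightarrow> bool" (infix "\<sqsubseteq>" 50) where
  "x \<sqsubseteq> y \<longleftrightarrow> x \<boxplus> y = y"

lemma le_refl: "x \<in> carrier S \<Longrightarrow> x \<sqsubseteq> x"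
  by (simp add: le_def add_idem)

lemma le_trans:
  "x \<sqsubseteq> y \<Longrightarrow> y \<sqsubseteq> z \<Longrightarrow> x \<in> carrier S \<Longrightarrow> y \<in> carrier S \<Longrightarrow> z \<in> carrier S \<Longrightarrow> x \<sqsubseteq> z"
  unfolding le_def by (metis add_assoc)

lemma le_antisym: "x \<sqsubseteq> y \<Longrightarrow> y \<sqsubseteq> x \<Longrightarrow> x \<in> carrier S \<Longrightarrow> y \<in> carrier S \<Longrightarrow> x = y"
  unfolding le_def by (metis add_comm)

lemma add_le_iff:
  assumes "x \<in> carrier S" "y \<in> carrier S" "z \<in> carrier S"
  shows "x \<boxplus> y \<sqsubseteq> z \<longleftrightarrow> x \<sqsubseteq> z \<and> y \<sqsubseteq> z"
proof
  assume "x \<boxplus> y \<sqsubseteq> z"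
  then have z: "z = x \<boxplus> (y \<boxplus> z)" using assms by (simp add: le_def add_assoc)
  have "x \<boxplus> z = z" using assms z by (metis add_assoc add_closed add_idem)
  moreover have "y \<boxplus> z = z" using assms z by (metis add_assoc add_closed add_comm add_idem)
  ultimately show "x \<sqsubseteq> z \<and> y \<sqsubseteq> z" by (simp add: le_def)
qed (use assms in \<open>simp add: le_def add_assoc\<close>)

lemma mul_left_mono:
  "x \<sqsubseteq> y \<Longrightarrow> x \<in> carrier S \<Longrightarrow> y \<in> carrier S \<Longrightarrow> z \<in> carrier S \<Longrightarrow> z \<boxdot> x \<sqsubseteq> z \<boxdot> y"
  unfolding le_def by (metis distrib_left)

lemma eval_word_closed:
  assumes "range \<phi> \<subseteq> carrier S" "u \<noteq> []"
  shows "eval_word S \<phi> u \<in> carrier S"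
  unfolding eval_word_def using assms by (intro fold1_closed mul_closed) auto

lemma eval_poly_closed:
  assumes "range \<phi> \<subseteq> carrier S" "is_sr_poly us"
  shows "eval_poly S \<phi> us \<in> carrier S"
  unfolding eval_poly_def using assms
  by (intro fold1_closed add_closed) (auto simp: is_sr_poly_def intro: eval_word_closed)

lemma eval_word_append:
  assumes "range \<phi> \<subseteq> carrier S" "u \<noteq> []" "v \<noteq> []"
  shows "eval_word S \<phi> (u @ v) = eval_word S \<phi> u \<boxdot> eval_word S \<phi> v"
  using assms(2)
proof (induction u rule: list_nonempty_induct)
  case (cons x u)
  then show ?case using assms
    by (simp add: eval_word_Cons mul_assoc eval_word_closed range_subsetD[OF assms(1)])
qed (use assms in \<open>simp add: eval_word_Cons\<close>)

text \<open>Allows an identity in single letters to be applied with whole words in their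
  place.\<close>

lemma eval_word_substitute:
  assumes "range \<phi> \<subseteq> carrier S" "\<And>x. \<sigma> x \<noteq> []" "u \<noteq> []"
  shows "eval_word S (\<lambda>x. eval_word S \<phi> (\<sigma> x)) u = eval_word S \<phi> (concat (map \<sigma> u))"
  using assms(3)
proof (induction u rule: list_nonempty_induct)
  case (cons x u)
  moreover from cons(1) have "concat (map \<sigma> u) \<noteq> []" using assms(2) by (cases u) auto
  ultimately show ?case using assms by (simp add: eval_word_Cons eval_word_append)
qed simp

text \<open>Iterating \<open>add_le_iff\<close>, a polynomial is the supremum of its words, so
  polynomials can be compared by bounding one word at a time.\<close>

lemma eval_poly_le_iff:
  assumes "range \<phi> \<subseteq> carrier S" "is_sr_poly us" "z \<in> carrier S"
  shows "eval_poly S \<phi> us \<sqsubseteq> z \<longleftrightarrow> (\<forall>u \<in> set us. eval_word S \<phi> u \<sqsubseteq> z)"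
proof -
  have "us \<noteq> []" "\<forall>u \<in> set us. u \<noteq> []" using assms by (auto simp: is_sr_poly_def)
  then show ?thesis
  proof (induction us rule: list_nonempty_induct)
    case (cons u us)
    then show ?case using assms(1,3)
      by (simp add: eval_poly_Cons add_le_iff eval_word_closed eval_poly_closed is_sr_poly_def)
  qed simp
qed

lemma eval_word_le_eval_poly:
  assumes "range \<phi> \<subseteq> carrier S" "is_sr_poly us" "u \<in> set us"
  shows "eval_word S \<phi> u \<sqsubseteq> eval_poly S \<phi> us"
  using assms eval_poly_le_iff eval_poly_closed le_refl by blast

end

section \<open>The basis\<close>

text \<open>For \<open>n = 1\<close> the only deletion would leave the empty word, which has no
  value; triviality is expressed by x = y instead.\<close>

definition subword_basis :: "nat \<Rightarrow> nat sr_identity set" where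
  "subword_basis n =
    {([[0], [0, 1]], [[0, 1]]), ([[1], [0, 1]], [[0, 1]]),
     (if n = 1 then ([[0]], [[1]]) else ([[0..<n]], deletions [0..<n]))}"

lemma is_sr_poly_deletions: "length xs \<ge> 2 \<Longrightarrow> is_sr_poly (deletions xs)"
  using length_deletions[of "[]" xs] by (auto simp: is_sr_poly_def deletions_def)

text \<open>The invariant that decides whether an identity holds. The empty word is excluded since
  it cannot be evaluated; for \<open>n = 1\<close> nothing remains, in accordance with
  \<open>R_sr 1\<close> having one element.\<close>

definition short_subwords :: "nat \<Rightarrow> 'v sr_poly \<Rightarrow> 'v list set" where
  "short_subwords n us = {w. w \<noteq> [] \<and> length w < n \<and> (\<exists>u \<in> set us. subseq w u)}"

section \<open>Consequences of the basis identities in an arbitrary ai-semiring\<close>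

context ai_semiring
begin

lemma le_mul:
  assumes "satisfies S (([[0], [0, 1]], [[0, 1]]) :: nat sr_identity)"
    and "satisfies S (([[1], [0, 1]], [[0, 1]]) :: nat sr_identity)"
    and "x \<in> carrier S" "y \<in> carrier S"
  shows "x \<sqsubseteq> x \<boxdot> y" "y \<sqsubseteq> x \<boxdot> y"
proof -
  define \<phi> where "\<phi> i = (if i = 0 then x else y)" for i :: nat
  have "range \<phi> \<subseteq> carrier S" using assms by (auto simp: \<phi>_def)
  then have "eval_poly S \<phi> [[0], [0, 1]] = eval_poly S \<phi> [[0, 1]]"
    "eval_poly S \<phi> [[1], [0, 1]] = eval_poly S \<phi> [[0, 1]]"
    using assms(1,2) unfolding satisfies_def by auto
  then show "x \<sqsubseteq> x \<boxdot> y" "y \<sqsubseteq> x \<boxdot> y"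
    by (simp_all add: le_def \<phi>_def eval_poly_Cons eval_word_Cons)
qed

text \<open>A skipped letter raises the value because y \<sqsubseteq> xy; a common first letter
  preserves the order by distributivity. The assumption on products is kept abstract so that it
  serves both for models of the basis and for \<open>R_sr n\<close>.\<close>

lemma eval_word_mono:
  assumes mul: "\<And>x y. x \<in> carrier S \<Longrightarrow> y \<in> carrier S \<Longrightarrow> x \<sqsubseteq> x \<boxdot> y \<and> y \<sqsubseteq> x \<boxdot> y"
    and \<phi>: "range \<phi> \<subseteq> carrier S" and "subseq w u" "w \<noteq> []"
  shows "eval_word S \<phi> w \<sqsubseteq> eval_word S \<phi> u"
  using assms(3,4)
proof (induction rule: list_emb.induct)
  case (list_emb_Cons w u a)
  then have ne: "u \<noteq> []" by auto
  have "eval_word S \<phi> u \<sqsubseteq> \<phi> a \<boxdot> eval_word S \<phi> u"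
    using mul \<phi> ne by (simp add: eval_word_closed range_subsetD)
  then show ?case using list_emb_Cons ne \<phi>
    by (auto simp: eval_word_Cons eval_word_closed range_subsetD mul_closed
        intro: le_trans[of _ "eval_word S \<phi> u"])
next
  case (list_emb_Cons2 a b w u)
  show ?case
  proof (cases "w = []")
    \<comment> \<open>Only the matched letter is left of the subword, so here x \<sqsubseteq> xy is
      used, or reflexivity if \<open>u\<close> is empty too.\<close>
    case True
    then show ?thesis using list_emb_Cons2(1) mul \<phi> le_refl
      by (cases "u = []") (auto simp: eval_word_Cons eval_word_closed range_subsetD)
  next
    case False
    moreover from this list_emb_Cons2(2) have "u \<noteq> []" by auto
    ultimately show ?thesis using list_emb_Cons2 \<phi>
      by (auto simp: eval_word_Cons eval_word_closed range_subsetD intro: mul_left_mono)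
  qed
qed simp

text \<open>Induction on the length: a word with at least \<open>n\<close> letters is cut into
  \<open>n\<close> nonempty blocks, and the last basis identity makes it the sum of the shorter
  words obtained by deleting one block. An arbitrary upper bound \<open>z\<close> avoids writing out
  the resulting sum of short words.\<close>

lemma eval_word_le_short:
  assumes n: "n \<ge> 1" and basis: "\<forall>e \<in> subword_basis n. satisfies S e"
    and \<phi>: "range \<phi> \<subseteq> carrier S" and z: "z \<in> carrier S" and u: "u \<noteq> []"
    and short: "\<And>w. subseq w u \<Longrightarrow> w \<noteq> [] \<Longrightarrow> length w < n \<Longrightarrow> eval_word S \<phi> w \<sqsubseteq> z"
  shows "eval_word S \<phi> u \<sqsubseteq> z"
  using u short
proof (induction "length u" arbitrary: u rule: less_induct)
  case less
  consider "n = 1" | "length u < n" | "n \<ge> 2" "length u \<ge> n" using n by linarith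
  then show ?case
  proof cases
    case 1
    \<comment> \<open>The identity x = y, instantiated with the value of \<open>u\<close> and with
      \<open>z\<close>, makes the two equal.\<close>
    let ?\<psi> = "\<lambda>i::nat. if i = 0 then eval_word S \<phi> u else z"
    have "satisfies S (([[0]], [[1]]) :: nat sr_identity)"
      using basis 1 by (simp add: subword_basis_def)
    moreover have "range ?\<psi> \<subseteq> carrier S" using eval_word_closed[OF \<phi> less.prems(1)] z by auto
    ultimately have "eval_poly S ?\<psi> [[0]] = eval_poly S ?\<psi> [[1]]"
      unfolding satisfies_def fst_conv snd_conv by blast
    then show ?thesis using le_refl[OF z] by simp
  next
    case 2
    then show ?thesis using less.prems by simp
  next
    case 3
    define m where "m = n - 1"
    \<comment> \<open>The blocks: the first \<open>n - 1\<close> letters one by one, then the whole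
      rest of \<open>u\<close>. All larger indices also get the rest, so that no letter is sent to
      the empty word.\<close>
    define \<sigma> where "\<sigma> i = (if i < m then [u ! i] else drop m u)" for i
    define \<psi> where "\<psi> = (\<lambda>i. eval_word S \<phi> (\<sigma> i))"
    have m: "n = Suc m" "m < length u" using 3 by (auto simp: m_def)
    have \<sigma>: "\<sigma> i \<noteq> []" for i using m by (simp add: \<sigma>_def)
    have "map \<sigma> [0..<m] = map (\<lambda>i. [u ! i]) [0..<m]" by (simp add: \<sigma>_def)
    then have "concat (map \<sigma> [0..<m]) = map ((!) u) [0..<m]" by (simp only: concat_map_singleton)
    also have "\<dots> = take m u" using m map_nth[of "take m u"]
      by (intro nth_equalityI) auto
    finally have concat: "concat (map \<sigma> [0..<n]) = u" using m by (simp add: \<sigma>_def)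
    have \<psi>: "range \<psi> \<subseteq> carrier S" using \<sigma> \<phi> by (auto simp: \<psi>_def eval_word_closed)
    have "satisfies S ([[0..<n]], deletions [0..<n])"
      using basis 3 by (auto simp: subword_basis_def)
    then have "eval_word S \<psi> [0..<n] = eval_poly S \<psi> (deletions [0..<n])"
      using \<psi> unfolding satisfies_def fst_conv snd_conv by (metis eval_poly_single)
    moreover have "eval_word S \<psi> [0..<n] = eval_word S \<phi> u"
      unfolding \<psi>_def using eval_word_substitute[of \<phi> \<sigma> "[0..<n]"] \<phi> \<sigma> n concat by simp
    ultimately have eq: "eval_word S \<phi> u = eval_poly S \<psi> (deletions [0..<n])" by simp
    have poly: "is_sr_poly (deletions [0..<n])" using 3 by (simp add: is_sr_poly_deletions)
    then have ne: "v \<noteq> []" if "v \<in> set (deletions [0..<n])" for v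
      using that by (auto simp: is_sr_poly_def)
    have "eval_word S \<psi> v \<sqsubseteq> z" if v: "v \<in> set (deletions [0..<n])" for v
    proof -
      let ?w = "concat (map \<sigma> v)"
      have sub: "subseq ?w u" using subseq_concat_map[OF subseq_deletions[OF v], of \<sigma>] concat by simp
      \<comment> \<open>Strict because the block of the deleted letter is nonempty.\<close>
      have "length ?w < length (concat (map \<sigma> [0..<n]))"
        using v \<sigma> by (elim deletionsE) simp
      moreover have "?w \<noteq> []" using ne[OF v] \<sigma> by (cases v) auto
      ultimately have "eval_word S \<phi> ?w \<sqsubseteq> z"
        using less.hyps[of ?w] less.prems(2) sub concat
        by (metis subseq_order.order_trans)
      then show ?thesis using eval_word_substitute[OF \<phi> \<sigma> ne[OF v]] by (simp add: \<psi>_def)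
    qed
    then show ?thesis using eq eval_poly_le_iff[OF \<psi> poly z] by simp
  qed
qed

text \<open>Each word on the left is bounded through its short subwords, and each of these embeds
  into a word on the right, which lies above it.\<close>

lemma eval_poly_le_if_short_subwords_subset:
  assumes n: "n \<ge> 1" and basis: "\<forall>e \<in> subword_basis n. satisfies S e"
    and \<phi>: "range \<phi> \<subseteq> carrier S" and us: "is_sr_poly us" and vs: "is_sr_poly vs"
    and sub: "short_subwords n us \<subseteq> short_subwords n vs"
  shows "eval_poly S \<phi> us \<sqsubseteq> eval_poly S \<phi> vs"
proof -
  have z: "eval_poly S \<phi> vs \<in> carrier S" by (rule eval_poly_closed[OF \<phi> vs])
  have mul: "x \<sqsubseteq> x \<boxdot> y \<and> y \<sqsubseteq> x \<boxdot> y" if "x \<in> carrier S" "y \<in> carrier S" for x y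
    using le_mul that basis by (auto simp: subword_basis_def)
  have "eval_word S \<phi> u \<sqsubseteq> eval_poly S \<phi> vs" if u: "u \<in> set us" for u
  proof (rule eval_word_le_short[OF n basis \<phi> z])
    show "u \<noteq> []" using u us by (auto simp: is_sr_poly_def)
  next
    fix w assume w: "subseq w u" "w \<noteq> []" "length w < n"
    then have "w \<in> short_subwords n vs" using u sub by (auto simp: short_subwords_def)
    then obtain v where v: "v \<in> set vs" "subseq w v" by (auto simp: short_subwords_def)
    then have "v \<noteq> []" using w by auto
    then show "eval_word S \<phi> w \<sqsubseteq> eval_poly S \<phi> vs"
      using eval_word_mono[OF mul \<phi> v(2) w(2)] eval_word_le_eval_poly[OF \<phi> vs v(1)] w \<phi> z
      by (auto intro: le_trans simp: eval_word_closed)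
  qed
  then show ?thesis using eval_poly_le_iff[OF \<phi> us z] by blast
qed

lemma satisfies_if_short_subwords_eq:
  fixes e :: "'v sr_identity"
  assumes "n \<ge> 1" "\<forall>e \<in> subword_basis n. satisfies S e" "is_sr_identity e"
    and "short_subwords n (fst e) = short_subwords n (snd e)"
  shows "satisfies S e"
  unfolding satisfies_def
proof (intro allI impI)
  fix \<phi> :: "'v \<Rightarrow> 'a" assume \<phi>: "range \<phi> \<subseteq> carrier S"
  have "is_sr_poly (fst e)" "is_sr_poly (snd e)" using assms(3) by (auto simp: is_sr_identity_def)
  then show "eval_poly S \<phi> (fst e) = eval_poly S \<phi> (snd e)"
    using assms(4)
    by (intro le_antisym eval_poly_closed[OF \<phi>]
        eval_poly_le_if_short_subwords_subset[OF assms(1,2) \<phi>]) auto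
qed

end

section \<open>Reflexive relations\<close>

lemma bool_sr_neq_one_iff: "(a::bool_sr) \<noteq> 1 \<longleftrightarrow> a = 0"
  by (cases a) (auto simp: one_bool_sr_def zero_bool_sr_def)

lemma bool_sr_add_eq_one_iff: "(a::bool_sr) + b = 1 \<longleftrightarrow> a = 1 \<or> b = 1"
  by (cases a; cases b) (auto simp: one_bool_sr_def plus_bool_sr_def)

lemma bool_sr_add_eq_right_iff: "(a::bool_sr) + b = b \<longleftrightarrow> (a = 1 \<longrightarrow> b = 1)"
  by (cases a; cases b) (auto simp: one_bool_sr_def plus_bool_sr_def)

lemma bool_sr_mult_eq_one_iff: "(a::bool_sr) * b = 1 \<longleftrightarrow> a = 1 \<and> b = 1"
  by (cases a; cases b) (auto simp: one_bool_sr_def times_bool_sr_def)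

lemma bool_sr_eqI: "((a::bool_sr) = 1 \<longleftrightarrow> b = 1) \<Longrightarrow> a = b"
  by (metis bool_sr_neq_one_iff)

lemma bool_sr_sum_eq_one_iff:
  "finite K \<Longrightarrow> (\<Sum>k\<in>K. f k :: bool_sr) = 1 \<longleftrightarrow> (\<exists>k\<in>K. f k = 1)"
  by (induction K rule: finite_induct) (auto simp: bool_sr_add_eq_one_iff bool_sr_neq_one_iff)

lemma mat_mult_eq_one_iff:
  fixes A B :: "bool_sr mat"
  assumes "A \<in> carrier_mat n n" "B \<in> carrier_mat n n" "i < n" "j < n"
  shows "(A * B) $$ (i, j) = 1 \<longleftrightarrow> (\<exists>k<n. A $$ (i, k) = 1 \<and> B $$ (k, j) = 1)"
proof -
  have "(A * B) $$ (i, j) = (\<Sum>k \<in> {0..<n}. A $$ (i, k) * B $$ (k, j))"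
    using assms by (simp add: scalar_prod_def)
  then show ?thesis by (auto simp: bool_sr_sum_eq_one_iff bool_sr_mult_eq_one_iff)
qed

section \<open>The order of \<open>R_sr n\<close>, and walks\<close>

interpretation R: ai_semiring "R_sr n" for n
  by (rule ai_semiring_R)

lemma R_sr_simps:
  "carrier (R_sr n) = {A \<in> carrier_mat n n. \<forall>i<n. A $$ (i, i) = 1}"
  "sadd (R_sr n) = (+)" "smul (R_sr n) = (*)"
  by (simp_all add: R_sr_def)

lemma R_le_iff:
  assumes "A \<in> carrier (R_sr n)" "B \<in> carrier (R_sr n)"
  shows "R.le n A B \<longleftrightarrow> (\<forall>i<n. \<forall>j<n. A $$ (i, j) = 1 \<longrightarrow> B $$ (i, j) = 1)"
proof -
  have "A + B = B \<longleftrightarrow> (\<forall>i<n. \<forall>j<n. A $$ (i, j) + B $$ (i, j) = B $$ (i, j))"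
    using assms by (auto simp: R_sr_simps mat_eq_iff)
  also have "\<dots> \<longleftrightarrow> (\<forall>i<n. \<forall>j<n. A $$ (i, j) = 1 \<longrightarrow> B $$ (i, j) = 1)"
    by (simp add: bool_sr_add_eq_right_iff)
  finally show ?thesis by (simp add: R.le_def R_sr_simps)
qed

text \<open>By reflexivity, a pair in one factor can be composed with a loop in the other.\<close>

lemma R_le_mul:
  assumes "A \<in> carrier (R_sr n)" "B \<in> carrier (R_sr n)"
  shows "R.le n A (A * B)" "R.le n B (A * B)"
proof -
  have AB: "A * B \<in> carrier (R_sr n)" using R.mul_closed[OF assms] by (simp add: R_sr_simps)
  show "R.le n A (A * B)" "R.le n B (A * B)"
    using assms unfolding R_le_iff[OF assms(1) AB] R_le_iff[OF assms(2) AB]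
    by (auto simp: R_sr_simps mat_mult_eq_one_iff[of A n B] simp del: index_mult_mat)
qed

text \<open>Entries of a product record labelled walks. The walk is a total function with all values
  below \<open>n\<close>, so it can be shifted and reindexed without side conditions; only its
  values up to \<open>length u\<close> matter.\<close>

lemma eval_word_R_eq_one_iff:
  assumes \<phi>: "range \<phi> \<subseteq> carrier (R_sr n)" and u: "u \<noteq> []" and "i < n" "j < n"
  shows "eval_word (R_sr n) \<phi> u $$ (i, j) = 1 \<longleftrightarrow>
    (\<exists>f. f 0 = i \<and> f (length u) = j \<and> (\<forall>t. f t < n) \<and>
      (\<forall>t < length u. \<phi> (u ! t) $$ (f t, f (Suc t)) = 1))"
  using u \<open>i < n\<close>
proof (induction u arbitrary: i rule: list_nonempty_induct)
  case (single x)
  show ?case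
  proof
    assume "eval_word (R_sr n) \<phi> [x] $$ (i, j) = 1"
    then show "\<exists>f. f 0 = i \<and> f (length [x]) = j \<and> (\<forall>t. f t < n) \<and>
      (\<forall>t < length [x]. \<phi> ([x] ! t) $$ (f t, f (Suc t)) = 1)"
      using single \<open>j < n\<close> by (intro exI[of _ "case_nat i (\<lambda>_. j)"]) (auto split: nat.split)
  qed auto
next
  case (cons x u)
  have c: "\<phi> x \<in> carrier_mat n n" "eval_word (R_sr n) \<phi> u \<in> carrier_mat n n"
    using R.eval_word_closed[OF \<phi> cons(1)] range_subsetD[OF \<phi>, of x] by (auto simp: R_sr_simps)
  have "eval_word (R_sr n) \<phi> (x # u) $$ (i, j) = 1 \<longleftrightarrow>
      (\<exists>k<n. \<phi> x $$ (i, k) = 1 \<and> eval_word (R_sr n) \<phi> u $$ (k, j) = 1)"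
    using cons(1,3) \<open>j < n\<close> c
    by (simp add: eval_word_Cons R_sr_simps mat_mult_eq_one_iff del: index_mult_mat)
  also have "\<dots> \<longleftrightarrow> (\<exists>f. f 0 = i \<and> f (length (x # u)) = j \<and> (\<forall>t. f t < n) \<and>
      (\<forall>t < length (x # u). \<phi> ((x # u) ! t) $$ (f t, f (Suc t)) = 1))" (is "?L \<longleftrightarrow> ?R")
  proof
    assume ?L
    then obtain k f where k: "k < n" "\<phi> x $$ (i, k) = 1" and f: "f 0 = k" "f (length u) = j"
      "\<forall>t. f t < n" "\<forall>t < length u. \<phi> (u ! t) $$ (f t, f (Suc t)) = 1"
      using cons.IH by blast
    then show ?R using cons.prems
      by (intro exI[of _ "case_nat i f"]) (auto simp: nth_Cons split: nat.split)
  next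
    assume ?R
    then obtain f where f: "f 0 = i" "f (Suc (length u)) = j" "\<And>t. f t < n"
      "\<And>t. t < Suc (length u) \<Longrightarrow> \<phi> ((x # u) ! t) $$ (f t, f (Suc t)) = 1" by auto
    \<comment> \<open>Dropping the first vertex leaves a walk along \<open>u\<close> from
      \<open>f 1\<close>.\<close>
    have "eval_word (R_sr n) \<phi> u $$ (f 1, j) = 1"
      unfolding cons.IH[OF f(3)] using f f(4)[of "Suc _"]
      by (intro exI[of _ "f \<circ> Suc"]) auto
    then show ?L using f f(4)[of 0] by (intro exI[of _ "f 1"]) auto
  qed
  finally show ?case .
qed

lemma R_eval_word_deletion:
  assumes \<phi>: "range \<phi> \<subseteq> carrier (R_sr n)" and u: "length u = n" "n \<ge> 2" and ij: "i < n" "j < n"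
    and one: "eval_word (R_sr n) \<phi> u $$ (i, j) = 1"
  obtains v where "v \<in> set (deletions u)" "eval_word (R_sr n) \<phi> v $$ (i, j) = 1"
proof -
  have "u \<noteq> []" using u by auto
  then obtain f where f: "f 0 = i" "f n = j" "\<And>t. f t < n"
    "\<And>t. t < n \<Longrightarrow> \<phi> (u ! t) $$ (f t, f (Suc t)) = 1"
    using one u(1) eval_word_R_eq_one_iff[OF \<phi> _ ij, of u] by auto
  have "\<not> inj_on f {..n}"
  proof
    assume "inj_on f {..n}"
    then have "card {..n} \<le> card {..<n}" using f(3) by (intro card_inj_on_le[of f]) auto
    then show False by simp
  qed
  then obtain a b where ab: "a < b" "b \<le> n" "f a = f b"
    unfolding inj_on_def by (metis atMost_iff linorder_neqE_nat)
  define v where "v = take a u @ drop (Suc a) u"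
  have v: "v \<in> set (deletions u)" using ab u by (auto simp: v_def deletions_def)
  have len: "Suc (length v) = n" using length_deletions[OF v] u by simp
  \<comment> \<open>The walk stays at \<open>f a = f b\<close> while the letters between the two visits are read.\<close>
  define g where "g t = (if t \<le> a then f t else if t < b then f b else f (Suc t))" for t
  have "\<phi> (v ! t) $$ (g t, g (Suc t)) = 1" if t: "t < length v" for t
  proof -
    have nth: "v ! t = u ! (if t < a then t else Suc t)"
      using t ab u by (auto simp: v_def nth_append)
    have refl: "\<phi> x $$ (f s, f s) = 1" for x s
      using range_subsetD[OF \<phi>, of x] f(3)[of s] by (auto simp: R_sr_simps)
    \<comment> \<open>From position \<open>a\<close> on, \<open>v\<close> has the letters of
      \<open>u\<close> shifted by one. The cases are: before the deleted letter, looping, leaving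
      the repeated vertex, and following \<open>f\<close> one step ahead.\<close>
    consider "t < a" | "a \<le> t" "Suc t < b" | "a \<le> t" "Suc t = b" | "b \<le> t" by linarith
    then show ?thesis
    proof cases
      case 1
      then show ?thesis using f(4)[of t] ab nth by (simp add: g_def)
    next
      case 2
      then show ?thesis using refl ab nth by (simp add: g_def)
    next
      case 3
      then have "g t = f b" "g (Suc t) = f (Suc b)"
        using ab by (cases "t = a"; auto simp: g_def)+
      then show ?thesis using f(4)[of b] 3 nth t len by simp
    next
      case 4
      then show ?thesis using f(4)[of "Suc t"] ab nth t len by (simp add: g_def)
    qed
  qed
  moreover have "g (length v) = j"
  \<comment> \<open>If the second visit is the end of the walk, \<open>g\<close> never resumes and
    ends while still at \<open>f b\<close>.\<close>
  proof (cases "b = n")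
    case True
    then have "length v < b" "length v \<le> a \<Longrightarrow> a = length v" using ab len by auto
    then show ?thesis using True ab f(2) by (auto simp: g_def)
  next
    case False
    then show ?thesis using ab len f(2) by (simp add: g_def)
  qed
  moreover have "g 0 = i" "\<And>t. g t < n" using f by (auto simp: g_def)
  moreover have "v \<noteq> []" using len u by auto
  ultimately have "eval_word (R_sr n) \<phi> v $$ (i, j) = 1"
    using eval_word_R_eq_one_iff[OF \<phi> _ ij, of v] by blast
  with v show thesis by (rule that)
qed

lemma R_satisfies_subword_basis:
  assumes n: "n \<ge> 1" and e: "e \<in> subword_basis n"
  shows "satisfies (R_sr n) e"
  unfolding satisfies_def
proof (intro allI impI)
  fix \<phi> :: "nat \<Rightarrow> bool_sr mat" assume \<phi>: "range \<phi> \<subseteq> carrier (R_sr n)"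
  have c: "\<phi> x \<in> carrier (R_sr n)" for x using \<phi> by blast
  have mul: "R.le n x (smul (R_sr n) x y) \<and> R.le n y (smul (R_sr n) x y)"
    if "x \<in> carrier (R_sr n)" "y \<in> carrier (R_sr n)" for x y
    using R_le_mul[OF that] by (simp add: R_sr_simps)
  consider "e = ([[0], [0, 1]], [[0, 1]])" | "e = ([[1], [0, 1]], [[0, 1]])"
    | "n = 1" "e = ([[0]], [[1]])" | "n \<ge> 2" "e = ([[0..<n]], deletions [0..<n])"
    using e n by (auto simp: subword_basis_def split: if_splits)
  then show "eval_poly (R_sr n) \<phi> (fst e) = eval_poly (R_sr n) \<phi> (snd e)"
  proof cases
    case 1
    then show ?thesis using mul[OF c[of 0] c[of 1]]
      by (simp add: eval_poly_Cons eval_word_Cons R.le_def)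
  next
    case 2
    then show ?thesis using mul[OF c[of 0] c[of 1]]
      by (simp add: eval_poly_Cons eval_word_Cons R.le_def)
  next
    case 3
    \<comment> \<open>The single entry of a matrix in \<open>R_sr 1\<close> is diagonal, hence
      1.\<close>
    then show ?thesis using c[of 0] c[of 1] by (auto simp: R_sr_simps mat_eq_iff)
  next
    case 4
    have poly: "is_sr_poly (deletions [0..<n])" using 4 by (simp add: is_sr_poly_deletions)
    have ne: "[0..<n] \<noteq> []" using 4 by simp
    have cw: "eval_word (R_sr n) \<phi> [0..<n] \<in> carrier (R_sr n)"
      by (rule R.eval_word_closed[OF \<phi> ne])
    have cp: "eval_poly (R_sr n) \<phi> (deletions [0..<n]) \<in> carrier (R_sr n)"
      by (rule R.eval_poly_closed[OF \<phi> poly])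
    have "R.le n (eval_word (R_sr n) \<phi> [0..<n]) (eval_poly (R_sr n) \<phi> (deletions [0..<n]))"
      unfolding R_le_iff[OF cw cp]
    proof (intro allI impI)
      fix i j assume ij: "i < n" "j < n" and "eval_word (R_sr n) \<phi> [0..<n] $$ (i, j) = 1"
      then obtain v where v: "v \<in> set (deletions [0..<n])" "eval_word (R_sr n) \<phi> v $$ (i, j) = 1"
        using R_eval_word_deletion[OF \<phi> _ 4(1) ij, of "[0..<n]"] by auto
      have "eval_word (R_sr n) \<phi> v \<in> carrier (R_sr n)"
        using v(1) poly by (intro R.eval_word_closed[OF \<phi>]) (auto simp: is_sr_poly_def)
      then show "eval_poly (R_sr n) \<phi> (deletions [0..<n]) $$ (i, j) = 1"
        using R.eval_word_le_eval_poly[OF \<phi> poly v(1)] R_le_iff[OF _ cp] v(2) ij by blast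
    qed
    moreover have "R.le n (eval_poly (R_sr n) \<phi> (deletions [0..<n])) (eval_word (R_sr n) \<phi> [0..<n])"
      unfolding R.eval_poly_le_iff[OF \<phi> poly cw]
      using poly by (auto simp: is_sr_poly_def intro!: R.eval_word_mono[OF mul \<phi>] subseq_deletions)
    ultimately have "eval_word (R_sr n) \<phi> [0..<n] = eval_poly (R_sr n) \<phi> (deletions [0..<n])"
      using cw cp by (rule R.le_antisym)
    then show ?thesis using 4 by simp
  qed
qed

section \<open>Comparing the three semirings\<close>

lemma identities_R_subset_U: "identities_of (R_sr n) \<subseteq> identities_of (U_sr n)"
proof -
  have "carrier (U_sr n) \<subseteq> carrier (R_sr n)" by (auto simp: U_sr_def)
  moreover have "eval_poly (U_sr n) = (eval_poly (R_sr n) :: (nat \<Rightarrow> _) \<Rightarrow> _)"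
    by (simp add: fun_eq_iff eval_poly_def eval_word_def[abs_def] U_sr_def)
  ultimately show ?thesis unfolding identities_of_def satisfies_def by force
qed

text \<open>Relates \<open>q\<close> to the whole interval up to \<open>\<alpha> q\<close> rather
  than to \<open>\<alpha> q\<close> alone: intervals with a common left end unite to the longer one,
  matching pointwise suprema, and extensivity puts \<open>q\<close> in its interval, which gives the
  diagonal.\<close>

definition transf_mat :: "nat \<Rightarrow> (nat \<Rightarrow> nat) \<Rightarrow> bool_sr mat" where
  "transf_mat n \<alpha> = mat n n (\<lambda>(q, r). if q \<le> r \<and> r \<le> \<alpha> q then 1 else 0)"

lemma transf_mat_eq_one_iff:
  "q < n \<Longrightarrow> r < n \<Longrightarrow> transf_mat n \<alpha> $$ (q, r) = 1 \<longleftrightarrow> q \<le> r \<and> r \<le> \<alpha> q"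
  by (simp add: transf_mat_def)

lemma transf_mat_carrier: "transf_mat n \<alpha> \<in> carrier_mat n n"
  by (simp add: transf_mat_def)

lemma carrier_C_D:
  assumes "\<alpha> \<in> carrier (C_sr n)"
  shows "q < n \<Longrightarrow> \<alpha> q < n" "q < n \<Longrightarrow> q \<le> \<alpha> q" "\<alpha> \<in> extensional {..<n}"
    "q \<le> r \<Longrightarrow> r < n \<Longrightarrow> \<alpha> q \<le> \<alpha> r"
  using assms by (auto simp: C_sr_def PiE_iff mono_on_def)

lemma transf_mat_closed: "\<alpha> \<in> carrier (C_sr n) \<Longrightarrow> transf_mat n \<alpha> \<in> carrier (U_sr n)"
  by (auto simp: U_sr_def R_sr_simps transf_mat_def carrier_C_D upper_triangular_def)

text \<open>\<open>\<alpha> q\<close> is recovered as the last column with entry 1 in row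
  \<open>q\<close>.\<close>

lemma inj_on_transf_mat: "inj_on (transf_mat n) (carrier (C_sr n))"
proof (rule inj_onI)
  fix \<alpha> \<beta> assume \<alpha>: "\<alpha> \<in> carrier (C_sr n)" and \<beta>: "\<beta> \<in> carrier (C_sr n)"
    and eq: "transf_mat n \<alpha> = transf_mat n \<beta>"
  have iff: "q \<le> r \<Longrightarrow> r \<le> \<alpha> q \<longleftrightarrow> r \<le> \<beta> q" if "q < n" "r < n" for q r
    using transf_mat_eq_one_iff[OF that] eq by metis
  show "\<alpha> = \<beta>"
  proof (rule extensionalityI[of _ "{..<n}"])
    fix q assume "q \<in> {..<n}"
    then have "q < n" by simp
    then show "\<alpha> q = \<beta> q"
      using iff[of q "\<alpha> q"] iff[of q "\<beta> q"] carrier_C_D(1,2)[OF \<alpha>] carrier_C_D(1,2)[OF \<beta>]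
      by (simp add: order_antisym)
  qed (use \<alpha> \<beta> carrier_C_D(3) in auto)
qed

lemma transf_mat_add:
  assumes "\<alpha> \<in> carrier (C_sr n)" "\<beta> \<in> carrier (C_sr n)"
  shows "transf_mat n (sadd (C_sr n) \<alpha> \<beta>) = transf_mat n \<alpha> + transf_mat n \<beta>"
  using assms
  by (auto simp: transf_mat_def C_sr_def bool_sr_one_add sup_nat_def intro!: eq_matI)

lemma transf_mat_mul:
  assumes \<alpha>: "\<alpha> \<in> carrier (C_sr n)" and \<beta>: "\<beta> \<in> carrier (C_sr n)"
  shows "transf_mat n (smul (C_sr n) \<alpha> \<beta>) = transf_mat n \<alpha> * transf_mat n \<beta>"
proof (rule eq_matI)
  fix q s assume "q < dim_row (transf_mat n \<alpha> * transf_mat n \<beta>)"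
    "s < dim_col (transf_mat n \<alpha> * transf_mat n \<beta>)"
  then have qs: "q < n" "s < n" by (auto simp: transf_mat_def)
  note \<alpha>q = carrier_C_D(1,2)[OF \<alpha> qs(1)]
  have "(transf_mat n \<alpha> * transf_mat n \<beta>) $$ (q, s) = 1 \<longleftrightarrow>
      (\<exists>r<n. q \<le> r \<and> r \<le> \<alpha> q \<and> r \<le> s \<and> s \<le> \<beta> r)"
    using qs by (auto simp: mat_mult_eq_one_iff[OF transf_mat_carrier transf_mat_carrier]
        transf_mat_eq_one_iff simp del: index_mult_mat)
  also have "\<dots> \<longleftrightarrow> q \<le> s \<and> s \<le> \<beta> (\<alpha> q)"
  proof
    \<comment> \<open>Since \<open>\<beta>\<close> is monotone, no intermediate point reaches
      further than \<open>\<alpha> q\<close>.\<close>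
    assume "\<exists>r<n. q \<le> r \<and> r \<le> \<alpha> q \<and> r \<le> s \<and> s \<le> \<beta> r"
    then show "q \<le> s \<and> s \<le> \<beta> (\<alpha> q)"
      using carrier_C_D(4)[OF \<beta> _ \<alpha>q(1)] by (meson order_trans)
  next
    assume "q \<le> s \<and> s \<le> \<beta> (\<alpha> q)"
    \<comment> \<open>The intermediate point must not pass \<open>s\<close>, hence the minimum; when
      it is \<open>s\<close> itself, extensivity of \<open>\<beta>\<close> gives the last
      inequality.\<close>
    then show "\<exists>r<n. q \<le> r \<and> r \<le> \<alpha> q \<and> r \<le> s \<and> s \<le> \<beta> r"
      using \<alpha>q qs carrier_C_D(2)[OF \<beta> qs(2)]
      by (intro exI[of _ "min s (\<alpha> q)"]) (auto simp: min_def)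
  qed
  also have "\<dots> \<longleftrightarrow> transf_mat n (smul (C_sr n) \<alpha> \<beta>) $$ (q, s) = 1"
    using qs by (simp add: transf_mat_eq_one_iff C_sr_def compose_def)
  finally show "transf_mat n (smul (C_sr n) \<alpha> \<beta>) $$ (q, s) =
      (transf_mat n \<alpha> * transf_mat n \<beta>) $$ (q, s)"
    by (intro bool_sr_eqI) simp
qed (auto simp: transf_mat_def)

interpretation C: ai_semiring "C_sr n" for n
  by (rule ai_semiring_C)

text \<open>\<open>transf_mat n\<close> is an injective homomorphism, so an equality of values in
  \<open>U_sr n\<close> pulls back to \<open>C_sr n\<close>.\<close>

lemma identities_U_subset_C: "identities_of (U_sr n) \<subseteq> identities_of (C_sr n)"
proof
  fix e assume e: "e \<in> identities_of (U_sr n)"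
  have "eval_poly (C_sr n) \<phi> (fst e) = eval_poly (C_sr n) \<phi> (snd e)"
    if \<phi>: "range \<phi> \<subseteq> carrier (C_sr n)" for \<phi>
  proof -
    have hom: "eval_poly (U_sr n) (transf_mat n \<circ> \<phi>) us = transf_mat n (eval_poly (C_sr n) \<phi> us) \<and>
        eval_poly (C_sr n) \<phi> us \<in> carrier (C_sr n)" if "is_sr_poly us" for us
      using that \<phi>
      by (intro eval_poly_hom)
        (auto simp: C.add_closed C.mul_closed transf_mat_add transf_mat_mul U_sr_def R_sr_simps)
    have "range (transf_mat n \<circ> \<phi>) \<subseteq> carrier (U_sr n)"
      using \<phi> transf_mat_closed by fastforce
    then have "eval_poly (U_sr n) (transf_mat n \<circ> \<phi>) (fst e) =
        eval_poly (U_sr n) (transf_mat n \<circ> \<phi>) (snd e)"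
      using e by (auto simp: identities_of_def satisfies_def)
    then show ?thesis using hom e inj_on_transf_mat[of n]
      by (auto simp: identities_of_def is_sr_identity_def inj_on_def)
  qed
  then show "e \<in> identities_of (C_sr n)"
    using e by (auto simp: identities_of_def satisfies_def)
qed

section \<open>Chain transformations as automata reading words\<close>

lemma eval_word_C:
  assumes \<phi>: "range \<phi> \<subseteq> carrier (C_sr n)" and "u \<noteq> []" "q < n"
  shows "eval_word (C_sr n) \<phi> u q = fold \<phi> u q"
  using assms(2,3)
proof (induction u arbitrary: q rule: list_nonempty_induct)
  case (cons x u)
  \<comment> \<open>The left factor acts first, as in \<open>fold\<close>, and keeps the state
    inside the chain.\<close>
  then show ?case using carrier_C_D(1)[OF range_subsetD[OF \<phi>, of x]]
    by (auto simp: eval_word_Cons C_sr_def compose_def)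
qed simp

text \<open>Thresholds turn the pointwise maximum into a disjunction over the words.\<close>

lemma eval_poly_C_ge_iff:
  assumes \<phi>: "range \<phi> \<subseteq> carrier (C_sr n)" and us: "is_sr_poly us" and q: "q < n"
  shows "k \<le> eval_poly (C_sr n) \<phi> us q \<longleftrightarrow> (\<exists>u \<in> set us. k \<le> fold \<phi> u q)"
proof -
  have "us \<noteq> []" "\<forall>u \<in> set us. u \<noteq> []" using us by (auto simp: is_sr_poly_def)
  then show ?thesis
  proof (induction us rule: list_nonempty_induct)
    case (cons u us)
    have "eval_poly (C_sr n) \<phi> (u # us) q = max (fold \<phi> u q) (eval_poly (C_sr n) \<phi> us q)"
      using cons q eval_word_C[OF \<phi>, of u q] by (simp add: eval_poly_Cons C_sr_def sup_nat_def)
    then show ?case using cons by (auto simp: le_max_iff_disj)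
  qed (use q eval_word_C[OF \<phi>] in simp)
qed

text \<open>Reading a word from state \<open>q\<close>, these transformations match the letters of \<open>drop q w\<close>
  greedily.\<close>

definition detector :: "nat \<Rightarrow> 'v list \<Rightarrow> 'v \<Rightarrow> nat \<Rightarrow> nat" where
  "detector n w x = (\<lambda>q\<in>{..<n}. if q < length w \<and> w ! q = x then Suc q else q)"

text \<open>States rise by at most one, so a lower state never overtakes a higher one;
  \<open>length w < n\<close> leaves room for the final state \<open>length w\<close>.\<close>

lemma detector_closed: "length w < n \<Longrightarrow> detector n w x \<in> carrier (C_sr n)"
  by (fastforce simp: C_sr_def detector_def mono_on_def intro: Suc_leI le_neq_trans)

text \<open>Greedy matching loses nothing: if the first letters agree, an embedding may be assumed
  to match them. The start state is arbitrary because each match advances it.\<close>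

lemma fold_detector_ge_iff:
  assumes "length w < n" "q \<le> length w"
  shows "length w \<le> fold (detector n w) u q \<longleftrightarrow> subseq (drop q w) u"
  using assms(2)
proof (induction u arbitrary: q)
  case (Cons x u)
  show ?case
  proof (cases "q < length w")
    case True
    then have "drop q w = w ! q # drop (Suc q) w" by (simp add: Cons_nth_drop_Suc)
    then show ?thesis using True Cons.IH[of "Suc q"] Cons.IH[of q] assms(1)
      by (simp add: detector_def)
  next
    case False
    then show ?thesis using Cons.prems Cons.IH[of q] assms(1) by (simp add: detector_def)
  qed
qed (auto dest: list_emb_length)

text \<open>Under the substitution \<open>detector n w\<close>, state 0 is raised to
  \<open>length w\<close> exactly by those polynomials having a word that contains
  \<open>w\<close>.\<close>

lemma identities_C_short_subwords:
  assumes "e \<in> identities_of (C_sr n)"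
  shows "short_subwords n (fst e) = short_subwords n (snd e)"
proof -
  have "(\<exists>u \<in> set (fst e). subseq w u) \<longleftrightarrow> (\<exists>v \<in> set (snd e). subseq w v)"
    if w: "length w < n" for w
  proof -
    have \<phi>: "range (detector n w) \<subseteq> carrier (C_sr n)" using detector_closed[OF w] by auto
    have iff: "length w \<le> eval_poly (C_sr n) (detector n w) us 0 \<longleftrightarrow> (\<exists>u \<in> set us. subseq w u)"
      if "is_sr_poly us" for us
      using eval_poly_C_ge_iff[OF \<phi> that, of 0] w fold_detector_ge_iff[OF w, of 0] by auto
    have "eval_poly (C_sr n) (detector n w) (fst e) = eval_poly (C_sr n) (detector n w) (snd e)"
      using assms \<phi> by (auto simp: identities_of_def satisfies_def)
    then show ?thesis
      using iff[of "fst e"] iff[of "snd e"] assms by (auto simp: identities_of_def is_sr_identity_def)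
  qed
  then show ?thesis unfolding short_subwords_def by blast
qed

lemma is_sr_identity_subword_basis:
  assumes "n \<ge> 1" "e \<in> subword_basis n"
  shows "is_sr_identity e"
  using assms is_sr_poly_deletions[of "[0..<n]"]
  by (auto simp: subword_basis_def is_sr_identity_def is_sr_poly_def[of "[_]"]
      is_sr_poly_def[of "[_, _]"] split: if_splits)

theorem theorem1:
  fixes n :: nat
  assumes "n \<ge> 1"
  shows "identities_of (U_sr n) = identities_of (R_sr n) \<and>
         identities_of (R_sr n) = identities_of (C_sr n) \<and>
         (\<exists>E. finite E \<and> is_identity_basis TYPE(nat) (U_sr n) E
                       \<and> is_identity_basis TYPE('c) (U_sr n) E)"
proof -
  \<comment> \<open>This closes the cycle of inclusions R, U, C, R: identities of
    \<open>C_sr n\<close> preserve short subwords, and \<open>R_sr n\<close> is a model of the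
    basis.\<close>
  have "satisfies (R_sr n) e" if "e \<in> identities_of (C_sr n)" for e
    using R_satisfies_subword_basis[OF assms] identities_C_short_subwords[OF that] that
    by (intro R.satisfies_if_short_subwords_eq[OF assms]) (auto simp: identities_of_def)
  then have "identities_of (C_sr n) \<subseteq> identities_of (R_sr n)"
    by (auto simp: identities_of_def)
  then have eq: "identities_of (U_sr n) = identities_of (R_sr n)"
    "identities_of (R_sr n) = identities_of (C_sr n)"
    using identities_R_subset_U identities_U_subset_C by blast+
  have "subword_basis n \<subseteq> identities_of (U_sr n)"
    unfolding eq(1)
    using R_satisfies_subword_basis[OF assms] is_sr_identity_subword_basis[OF assms]
    by (auto simp: identities_of_def)
  \<comment> \<open>The same argument works with any model of the basis in place of
    \<open>R_sr n\<close>.\<close>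
  moreover have "satisfies A e"
    if "ai_semiring A" "\<forall>e \<in> subword_basis n. satisfies A e" "e \<in> identities_of (U_sr n)"
    for A :: "nat sr" and e
  proof (rule ai_semiring.satisfies_if_short_subwords_eq[OF that(1) assms that(2)])
    have "e \<in> identities_of (C_sr n)" using that(3) eq by simp
    then show "short_subwords n (fst e) = short_subwords n (snd e)"
      by (rule identities_C_short_subwords)
    show "is_sr_identity e" using that(3) by (simp add: identities_of_def)
  qed
  ultimately have "is_identity_basis TYPE(nat) (U_sr n) (subword_basis n)"
    unfolding is_identity_basis_def by blast
  moreover have "finite (subword_basis n)" by (simp add: subword_basis_def)
  ultimately show ?thesis using eq identity_basis_nat_imp_any by blast
qed

end
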